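(* For any $\varepsilon>0$, there exists a compact metric space $Z$ such that for any $\delta>0$, there is a subset $X\subseteq Z$ with $d_{\mathrm{H}}(X,Z)<\delta$ and $$d_{\mathrm{GH}}(X,Z) < \varepsilon \cdot d_{\mathrm{H}}(X,Z).$$
   Context: For subsets $X,Y$ of a metric space $(Z,d)$, the $\varepsilon$-thickening of $X$ is $X^\varepsilon=\{z\in Z : d(z,x)<\varepsilon \text{ for some } x\in X\}$, and the Hausdorff distance is $d_{\mathrm{H}}(X,Y)=\inf\{\varepsilon>0 : X\subseteq Y^\varepsilon \text{ and } Y\subseteq X^\varepsilon\}$. A subset $X\subseteq Z$ is regarded as a metric space with the restricted metric. All metric spaces whose Gromov--Hausdorff distance is taken are nonempty. The Gromov--Hausdorff distance $d_{\mathrm{GH}}(X,Y)$ between metric spaces $X$ and $Y$ is the infimum, over all metric spaces $W$ and all distance-preserving maps $f\colon X\to W$ and $g\colon Y\to W$, of the Hausdorff distance in $W$ between $f(X)$ and $g(Y)$. Equivalently, $d_{\mathrm{GH}}(X,Y)=\frac12\inf_R \sup_{(x_1,y_1),(x_2,y_2)\in R}|d_X(x_1,x_2)-d_Y(y_1,y_2)|$, where $R$ ranges over all correspondences, i.e. subsets $R\subseteq X\times Y$ whose projections to $X$ and to $Y$ are both surjective. *)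

theory Defs
  imports "HOL-Analysis.Analysis"
begin

definition thickening :: "'a metric \<Rightarrow> real \<Rightarrow> 'a set \<Rightarrow> 'a set" where
  "thickening Z \<epsilon> X = {z \<in> mspace Z. \<exists>x\<in>X. mdist Z z x < \<epsilon>}"

text \<open>Distances between sets and between spaces take values in \<^typ>\<open>ennreal\<close>, so that the infimum
  over an empty set of admissible \<open>\<epsilon>\<close> is infinite.\<close>

definition hausdorff_distance :: "'a metric \<Rightarrow> 'a set \<Rightarrow> 'a set \<Rightarrow> ennreal" where
  "hausdorff_distance Z X Y =
     Inf {ennreal \<epsilon> | \<epsilon>. \<epsilon> > 0 \<and> X \<subseteq> thickening Z \<epsilon> Y \<and> Y \<subseteq> thickening Z \<epsilon> X}"

definition distance_preserving :: "'a metric \<Rightarrow> 'b metric \<Rightarrow> ('a \<Rightarrow> 'b) \<Rightarrow> bool" where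
  "distance_preserving X W f \<longleftrightarrow>
     f ` mspace X \<subseteq> mspace W \<and>
     (\<forall>x\<in>mspace X. \<forall>y\<in>mspace X. mdist W (f x) (f y) = mdist X x y)"

text \<open>The ambient spaces \<open>W\<close> have their points in the sum of the two point types. This loses no
  generality: only \<open>f(X) \<union> g(Y)\<close> matters, and every such union has an isometric copy
  there, see \<open>gromov_hausdorff_distance_le\<close> below, where \<open>W\<close> has an arbitrary point type.\<close>

definition gromov_hausdorff_distance :: "'a metric \<Rightarrow> 'b metric \<Rightarrow> ennreal" where
  "gromov_hausdorff_distance X Y =
     Inf {hausdorff_distance W (f ` mspace X) (g ` mspace Y) | (W :: ('a + 'b) metric) f g.
            distance_preserving X W f \<and> distance_preserving Y W g}"

lemma gromov_hausdorff_distance_le: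
  fixes X :: "'a metric" and Y :: "'b metric" and W :: "'c metric"
  assumes f: "distance_preserving X W f" and g: "distance_preserving Y W g"
  shows "gromov_hausdorff_distance X Y \<le> hausdorff_distance W (f ` mspace X) (g ` mspace Y)"
proof -
  define h where "h = case_sum f g"
  define C where "C = Inl ` mspace X \<union> Inr ` {y \<in> mspace Y. g y \<notin> f ` mspace X}"
  define d where "d = (\<lambda>u v. mdist W (h u) (h v))"
  define g' where
    "g' = (\<lambda>y. if g y \<in> f ` mspace X then Inl (inv_into (mspace X) f (g y)) else Inr y)"
  have fW: "f x \<in> mspace W" if "x \<in> mspace X" for x
    using f that by (auto simp: distance_preserving_def)
  have gW: "g y \<in> mspace W" if "y \<in> mspace Y" for y
    using g that by (auto simp: distance_preserving_def)
  have f_eq: "x = x'" if x: "x \<in> mspace X" "x' \<in> mspace X" "f x = f x'" for x x'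
  proof -
    have "mdist X x x' = mdist W (f x) (f x')"
      using f x(1,2) unfolding distance_preserving_def by simp
    also have "\<dots> = 0" using x fW[of x] fW[of x'] by (subst mdist_zero) auto
    finally show ?thesis using x(1,2) by (subst (asm) mdist_zero) auto
  qed
  have g_eq: "y = y'" if y: "y \<in> mspace Y" "y' \<in> mspace Y" "g y = g y'" for y y'
  proof -
    have "mdist Y y y' = mdist W (g y) (g y')"
      using g y(1,2) unfolding distance_preserving_def by simp
    also have "\<dots> = 0" using y gW[of y] gW[of y'] by (subst mdist_zero) auto
    finally show ?thesis using y(1,2) by (subst (asm) mdist_zero) auto
  qed
  have hW: "h u \<in> mspace W" if "u \<in> C" for u
    using that fW gW by (auto simp: C_def h_def)
  have h_eq: "u = v" if "u \<in> C" "v \<in> C" "h u = h v" for u v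
    using that f_eq g_eq unfolding C_def h_def by (elim UnE imageE) (auto simp: image_iff)
  interpret M: Metric_space C d
  proof
    show "0 \<le> d x y" for x y by (simp add: d_def)
    show "d x y = d y x" for x y by (simp add: d_def mdist_commute)
    show "d x y = 0 \<longleftrightarrow> x = y" if "x \<in> C" "y \<in> C" for x y
      unfolding d_def using that hW[of x] hW[of y] h_eq[of x y] by auto
    show "d x z \<le> d x y + d y z" if "x \<in> C" "y \<in> C" "z \<in> C" for x y z
      unfolding d_def using that by (intro mdist_triangle hW)
  qed
  have hf: "h (Inl x) = f x" for x by (simp add: h_def)
  have hg: "h (g' y) = g y" for y by (auto simp: h_def g'_def f_inv_into_f)
  have fC: "Inl x \<in> C" if "x \<in> mspace X" for x using that by (auto simp: C_def)
  have gC: "g' y \<in> C" if "y \<in> mspace Y" for y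
    using that by (auto simp: C_def g'_def inv_into_into)
  define V where "V = metric (C, d)"
  have V_space: "mspace V = C"
    unfolding V_def by (rule M.mspace_metric)
  have V_dist: "mdist V u v = mdist W (h u) (h v)" for u v
    unfolding V_def M.mdist_metric by (simp add: d_def)
  have "distance_preserving X V Inl"
    using f fC by (auto simp: distance_preserving_def V_space V_dist hf)
  moreover have "distance_preserving Y V g'"
    using g gC by (auto simp: distance_preserving_def V_space V_dist hg)
  ultimately have "gromov_hausdorff_distance X Y
      \<le> hausdorff_distance V (Inl ` mspace X) (g' ` mspace Y)"
    unfolding gromov_hausdorff_distance_def by (intro Inf_lower) blast
  also have "\<dots> = hausdorff_distance W (f ` mspace X) (g ` mspace Y)"
    using fC gC fW gW
    by (simp add: hausdorff_distance_def thickening_def image_subset_iff V_space V_dist hf hg)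
  finally show ?thesis .
qed

text \<open>Existence of a compact metric space is stated with points in \<^typ>\<open>real\<close> and an arbitrary
  metric on a set of such points. As compact metric spaces have at most the cardinality of the
  continuum, every one of them is isometric to a space of type \<^typ>\<open>real metric\<close>.\<close>

end

theory Submission
  imports Defs
begin

text \<open>Take \<open>Z = {0} \<union> {q^n | n}\<close> with \<open>q < 1\<close> close to \<open>1\<close> and the ultrametric \<open>d(x,y) = max x y\<close>
  for \<open>x \<noteq> y\<close>, and let \<open>X\<close> be \<open>Z\<close> without the point \<open>q^k\<close>. That point has distance at least \<open>q^k\<close>
  from every other one, so \<open>d\<^sub>H(X,Z) = q^k\<close>. But \<open>Z\<close> is mapped onto \<open>X\<close> by sending \<open>q^n\<close> to
  \<open>q^(n+1)\<close> for \<open>n \<ge> k\<close> and fixing the other points, which changes distances by at most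
  \<open>(1 - q) q^k\<close>.\<close>

section \<open>Bounds on the Hausdorff and Gromov-Hausdorff distances\<close>

text \<open>A thickening is given by a strict inequality, so \<open>r\<close> itself can fail to be
  admissible even when it is the infimum. Hence only radii above \<open>r\<close> are tested, and
  these decrease to \<open>r\<close>.\<close>

lemma hausdorff_distance_le:
  assumes "0 \<le> r"
    and "\<And>e. r < e \<Longrightarrow> X \<subseteq> thickening Z e Y \<and> Y \<subseteq> thickening Z e X"
  shows "hausdorff_distance Z X Y \<le> ennreal r"
proof (rule ennreal_le_epsilon)
  fix e :: real
  assume "0 < e"
  then have "hausdorff_distance Z X Y \<le> ennreal (r + e)"
    unfolding hausdorff_distance_def using assms by (intro Inf_lower CollectI exI[of _ "r + e"]) auto
  also have "\<dots> = ennreal r + ennreal e"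
    using \<open>0 < e\<close> assms(1) by (simp add: ennreal_plus)
  finally show "hausdorff_distance Z X Y \<le> ennreal r + ennreal e" .
qed

text \<open>A thickening of \<open>X\<close> by less than \<open>r\<close> misses the point
  \<open>z\<close>, so no radius below \<open>r\<close> is admissible.\<close>

lemma hausdorff_distance_ge:
  assumes "z \<in> Y" and "\<And>x. x \<in> X \<Longrightarrow> r \<le> mdist Z z x"
  shows "ennreal r \<le> hausdorff_distance Z X Y"
  unfolding hausdorff_distance_def
proof (rule Inf_greatest, clarify)
  fix e
  assume "0 < e" "Y \<subseteq> thickening Z e X"
  then obtain x where "x \<in> X" "mdist Z z x < e"
    using assms(1) unfolding thickening_def by blast
  then show "ennreal r \<le> ennreal e"
    using assms(2)[of x] by (intro ennreal_leI) linarith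
qed

text \<open>Glue \<open>X\<close> and \<open>Y\<close> by joining each \<open>y\<close> to
  \<open>\<phi> y\<close> with a bridge of length \<open>r\<close>. Since \<open>\<phi>\<close> is
  onto, each set lies within \<open>r\<close> of the other. Crossing two bridges costs
  \<open>2 * r\<close>, just what \<open>\<phi>\<close> may take off a distance.\<close>

lemma gromov_hausdorff_distance_le_distortion:
  fixes X :: "'a metric" and Y :: "'b metric"
  assumes onto: "\<phi> ` mspace Y = mspace X" and "0 < r"
    and le: "\<And>y z. \<lbrakk>y \<in> mspace Y; z \<in> mspace Y\<rbrakk> \<Longrightarrow> mdist X (\<phi> y) (\<phi> z) \<le> mdist Y y z"
    and ge: "\<And>y z. \<lbrakk>y \<in> mspace Y; z \<in> mspace Y\<rbrakk> \<Longrightarrow> mdist Y y z \<le> mdist X (\<phi> y) (\<phi> z) + 2 * r"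
  shows "gromov_hausdorff_distance X Y \<le> ennreal r"
proof -
  define C where "C = Inl ` mspace X \<union> Inr ` mspace Y"
  \<comment> \<open>As \<open>\<phi>\<close> does not expand distances, a shortest way from
    \<open>a\<close> to \<open>y\<close> crosses the bridge at \<open>y\<close> itself; the mixed
    clauses are its length.\<close>
  define d where "d = (\<lambda>u v. case (u, v) of
      (Inl a, Inl b) \<Rightarrow> mdist X a b
    | (Inl a, Inr y) \<Rightarrow> mdist X a (\<phi> y) + r
    | (Inr y, Inl a) \<Rightarrow> mdist X a (\<phi> y) + r
    | (Inr y, Inr z) \<Rightarrow> mdist Y y z)"
  have \<phi>X: "\<phi> y \<in> mspace X" if "y \<in> mspace Y" for y
    using onto that by blast
  interpret M: Metric_space C d
  proof
    show "0 \<le> d u v" for u v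
      using \<open>0 < r\<close> by (auto simp: d_def split: sum.split)
    show "d u v = d v u" for u v
      by (auto simp: d_def mdist_commute split: sum.split)
    show "d u v = 0 \<longleftrightarrow> u = v" if "u \<in> C" "v \<in> C" for u v
      using that \<open>0 < r\<close> mdist_nonneg[of X]
      by (auto simp: C_def d_def add_nonneg_eq_0_iff)
    \<comment> \<open>\<open>ge\<close> enters only for the detour from \<open>Y\<close> through
      \<open>X\<close> back to \<open>Y\<close>, and \<open>le\<close> only when one end is in
      \<open>X\<close> and the other two points are in \<open>Y\<close>.\<close>
    show "d u w \<le> d u v + d v w" if "u \<in> C" "v \<in> C" "w \<in> C" for u v w
      using that unfolding C_def
    proof (elim UnE imageE; hypsubst)
      fix a b c assume "a \<in> mspace X" "b \<in> mspace X" "c \<in> mspace X"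
      then show "d (Inl a) (Inl c) \<le> d (Inl a) (Inl b) + d (Inl b) (Inl c)"
        using mdist_triangle[of a X b c] by (simp add: d_def mdist_commute)
    next
      fix a b x assume "a \<in> mspace X" "b \<in> mspace X" "x \<in> mspace Y"
      then show "d (Inl a) (Inr x) \<le> d (Inl a) (Inl b) + d (Inl b) (Inr x)"
        using mdist_triangle[of a X b "\<phi> x"] \<phi>X[of x] by (simp add: d_def mdist_commute)
    next
      fix a x b assume "a \<in> mspace X" "x \<in> mspace Y" "b \<in> mspace X"
      then show "d (Inl a) (Inl b) \<le> d (Inl a) (Inr x) + d (Inr x) (Inl b)"
        using mdist_triangle[of a X "\<phi> x" b] \<phi>X[of x] \<open>0 < r\<close>
        by (simp add: d_def mdist_commute)
    next
      fix a x y assume "a \<in> mspace X" "x \<in> mspace Y" "y \<in> mspace Y"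
      then show "d (Inl a) (Inr y) \<le> d (Inl a) (Inr x) + d (Inr x) (Inr y)"
        using mdist_triangle[of a X "\<phi> x" "\<phi> y"] \<phi>X[of x] \<phi>X[of y] le[of x y]
        by (simp add: d_def mdist_commute)
    next
      fix x a b assume "x \<in> mspace Y" "a \<in> mspace X" "b \<in> mspace X"
      then show "d (Inr x) (Inl b) \<le> d (Inr x) (Inl a) + d (Inl a) (Inl b)"
        using mdist_triangle[of b X a "\<phi> x"] \<phi>X[of x] by (simp add: d_def mdist_commute)
    next
      fix x a y assume "x \<in> mspace Y" "a \<in> mspace X" "y \<in> mspace Y"
      then show "d (Inr x) (Inr y) \<le> d (Inr x) (Inl a) + d (Inl a) (Inr y)"
        using mdist_triangle[of "\<phi> x" X a "\<phi> y"] \<phi>X[of x] \<phi>X[of y] ge[of x y]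
        by (simp add: d_def mdist_commute)
    next
      fix x y a assume "x \<in> mspace Y" "y \<in> mspace Y" "a \<in> mspace X"
      then show "d (Inr x) (Inl a) \<le> d (Inr x) (Inr y) + d (Inr y) (Inl a)"
        using mdist_triangle[of a X "\<phi> y" "\<phi> x"] \<phi>X[of x] \<phi>X[of y] le[of x y]
        by (simp add: d_def mdist_commute)
    next
      fix x y z assume "x \<in> mspace Y" "y \<in> mspace Y" "z \<in> mspace Y"
      then show "d (Inr x) (Inr z) \<le> d (Inr x) (Inr y) + d (Inr y) (Inr z)"
        using mdist_triangle[of x Y y z] by (simp add: d_def mdist_commute)
    qed
  qed
  define W where "W = metric (C, d)"
  have W_space: "mspace W = C"
    unfolding W_def by (rule M.mspace_metric)
  have W_dist: "mdist W = d"
    unfolding W_def by (rule M.mdist_metric)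
  have cross: "mdist W (Inl (\<phi> y)) (Inr y) = r" "mdist W (Inr y) (Inl (\<phi> y)) = r"
    if "y \<in> mspace Y" for y
    using \<phi>X[OF that] by (auto simp: W_dist d_def)
  have "gromov_hausdorff_distance X Y \<le> hausdorff_distance W (Inl ` mspace X) (Inr ` mspace Y)"
    by (intro gromov_hausdorff_distance_le)
      (auto simp: distance_preserving_def W_space W_dist C_def d_def)
  also have "\<dots> \<le> ennreal r"
  proof (intro hausdorff_distance_le conjI)
    fix e assume "r < e"
    then show "Inl ` mspace X \<subseteq> thickening W e (Inr ` mspace Y)"
      using cross by (fastforce simp: thickening_def W_space C_def simp flip: onto)
    show "Inr ` mspace Y \<subseteq> thickening W e (Inl ` mspace X)"
      using cross \<phi>X \<open>r < e\<close> by (fastforce simp: thickening_def W_space C_def)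
  qed (use \<open>0 < r\<close> in simp)
  finally show ?thesis .
qed

section \<open>A compactness criterion\<close>

text \<open>A member of the cover that contains \<open>a\<close> contains a ball around
  \<open>a\<close>, which leaves out finitely many points; each of these takes one more
  member.\<close>

lemma (in Metric_space) compact_space_mtopologyI:
  assumes "a \<in> M" and fin: "\<And>r. 0 < r \<Longrightarrow> finite {x \<in> M. r \<le> d a x}"
  shows "compact_space mtopology"
  unfolding compact_space_def compactin_def
proof (intro conjI allI impI)
  fix \<U> assume \<U>: "Ball \<U> (openin mtopology) \<and> topspace mtopology \<subseteq> \<Union>\<U>"
  then obtain U where U: "U \<in> \<U>" "a \<in> U"
    using \<open>a \<in> M\<close> by auto
  then obtain r where r: "0 < r" "mball a r \<subseteq> U"
    using \<U> unfolding openin_mtopology by meson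
  have "\<forall>x\<in>M. \<exists>V\<in>\<U>. x \<in> V"
    using \<U> by auto
  then obtain V where V: "\<And>x. x \<in> M \<Longrightarrow> V x \<in> \<U> \<and> x \<in> V x"
    by metis
  have "x \<in> \<Union>(insert U (V ` {x \<in> M. r \<le> d a x}))" if "x \<in> M" for x
    using that V r \<open>a \<in> M\<close> by (cases "r \<le> d a x") (auto simp: subset_iff)
  then show "\<exists>\<F>. finite \<F> \<and> \<F> \<subseteq> \<U> \<and> topspace mtopology \<subseteq> \<Union>\<F>"
    using U V fin[OF r(1)] by (intro exI[of _ "insert U (V ` {x \<in> M. r \<le> d a x})"]) auto
qed simp

section \<open>The ultrametric space of powers and its punctured subsets\<close>

definition max_dist :: "real \<Rightarrow> real \<Rightarrow> real" where
  "max_dist x y = (if x = y then 0 else max x y)"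

text \<open>The absolute values make the function nonnegative off \<open>M\<close>, as the locale demands.\<close>

lemma Metric_space_max_dist:
  assumes "M \<subseteq> {0..}"
  shows "Metric_space M (\<lambda>x y. max_dist \<bar>x\<bar> \<bar>y\<bar>)"
proof
  show "max_dist \<bar>x\<bar> \<bar>y\<bar> = 0 \<longleftrightarrow> x = y" if "x \<in> M" "y \<in> M" for x y
    using subsetD[OF assms that(1)] subsetD[OF assms that(2)]
    by (auto simp: max_dist_def max_def split: if_splits)
qed (auto simp: max_dist_def max_def)

theorem theorem7p1:
  fixes \<epsilon> :: real
  assumes "\<epsilon> > 0"
  shows "\<exists>Z :: real metric.
           mspace Z \<noteq> {} \<and> compact_space (mtopology_of Z) \<and>
           (\<forall>\<delta>::real. \<delta> > 0 \<longrightarrow>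
             (\<exists>X. X \<noteq> {} \<and> X \<subseteq> mspace Z \<and>
                  hausdorff_distance Z X (mspace Z) < ennreal \<delta> \<and>
                  gromov_hausdorff_distance (submetric Z X) Z
                    < ennreal \<epsilon> * hausdorff_distance Z X (mspace Z)))"
proof -
  \<comment> \<open>The cap \<open>1/2\<close> keeps \<open>q\<close> positive when
    \<open>\<epsilon>\<close> is large.\<close>
  define q where "q = 1 - min \<epsilon> (1/2)"
  have q: "0 < q" "q < 1" "1 - q \<le> \<epsilon>"
    using assms by (auto simp: q_def)
  define M where "M = insert 0 (range (\<lambda>n. q ^ n))"
  have M_nonneg: "0 \<le> x" if "x \<in> M" for x
    using that q by (auto simp: M_def)
  define d where "d = (\<lambda>x y. max_dist \<bar>x\<bar> \<bar>y\<bar>)"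
  have d: "d x y = max_dist x y" if "x \<in> M" "y \<in> M" for x y
    using that M_nonneg by (simp add: d_def)
  interpret Metric_space M d
    unfolding d_def using M_nonneg by (intro Metric_space_max_dist) auto
  define Z where "Z = metric (M, d)"
  have Z[simp]: "mspace Z = M" "mdist Z = d" "mtopology_of Z = mtopology"
    unfolding Z_def by (auto simp: mtopology_of_def)
  have pow_small: "\<exists>n. q ^ n < r" if "0 < r" for r
    using real_arch_pow_inv[OF that q(2)] .
  have pow_mono: "q ^ m \<le> q ^ n" if "n \<le> m" for m n
    using that q by (intro power_decreasing) auto
  have "compact_space mtopology"
  proof (rule compact_space_mtopologyI[of 0])
    fix r :: real assume "0 < r"
    then obtain n where n: "q ^ n < r"
      using pow_small by blast
    have "{x \<in> M. r \<le> d 0 x} \<subseteq> (\<lambda>m. q ^ m) ` {..<n}"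
    proof clarify
      fix x assume x: "x \<in> M" "r \<le> d 0 x"
      then have "r \<le> x"
        using \<open>0 < r\<close> M_nonneg[of x] by (auto simp: d_def max_dist_def split: if_splits)
      then obtain m where m: "x = q ^ m"
        using x \<open>0 < r\<close> by (auto simp: M_def)
      have "m < n"
        using pow_mono[of n m] n m \<open>r \<le> x\<close> by linarith
      then show "x \<in> (\<lambda>m. q ^ m) ` {..<n}"
        using m by blast
    qed
    then show "finite {x \<in> M. r \<le> d 0 x}"
      by (rule finite_subset) simp
  qed (simp add: M_def)
  moreover have "\<exists>X. X \<noteq> {} \<and> X \<subseteq> M \<and>
      hausdorff_distance Z X M < ennreal \<delta> \<and>
      gromov_hausdorff_distance (submetric Z X) Z < ennreal \<epsilon> * hausdorff_distance Z X M"
    if "0 < \<delta>" for \<delta>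
  proof -
    obtain k where k: "q ^ k < \<delta>"
      using pow_small \<open>0 < \<delta>\<close> by blast
    define p where "p = q ^ k"
    have p: "0 < p" "p \<in> M" "p < \<delta>"
      using q k by (auto simp: p_def M_def)
    define X where "X = M - {p}"
    have X: "0 \<in> X" "X \<subseteq> M"
      using p by (auto simp: X_def M_def)
    \<comment> \<open>For \<open>x = q ^ n\<close> the condition \<open>x \<le> p\<close> means
      \<open>n \<ge> k\<close>, and \<open>0\<close> is fixed, so this is the shift of
      exponents.\<close>
    define \<phi> where "\<phi> = (\<lambda>x. if x \<le> p then q * x else x)"
    have H_le: "hausdorff_distance Z X M \<le> ennreal p"
    proof (intro hausdorff_distance_le conjI)
      fix e assume "p < e"
      show "X \<subseteq> thickening Z e M"
        using X p \<open>p < e\<close> by (fastforce simp: thickening_def d_def max_dist_def)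
      \<comment> \<open>Only \<open>p\<close> is missing from \<open>X\<close>; the point
        \<open>0\<close> is at distance exactly \<open>p\<close> from it.\<close>
      have "\<exists>x\<in>X. d z x < e" if "z \<in> M" for z
      proof (cases "z = p")
        case True
        then show ?thesis
          using X(1) p \<open>p < e\<close> by (intro bexI[of _ 0]) (auto simp: d_def max_dist_def)
      next
        case False
        then show ?thesis
          using that p \<open>p < e\<close> by (intro bexI[of _ z]) (auto simp: X_def)
      qed
      then show "M \<subseteq> thickening Z e X"
        by (auto simp: thickening_def)
    qed (use p in simp)
    have H_ge: "ennreal p \<le> hausdorff_distance Z X M"
      using p(2) by (rule hausdorff_distance_ge) (use d p in \<open>auto simp: X_def max_dist_def\<close>)
    have onto: "\<phi> ` M = X"
    proof (intro equalityI subsetI)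
      fix y assume "y \<in> \<phi> ` M"
      then obtain x where x: "x \<in> M" "y = \<phi> x" by blast
      have "q * x \<in> M"
        using x(1) by (auto simp: M_def simp flip: power_Suc)
      \<comment> \<open>The value is at most \<open>q * p\<close>, which is less than
        \<open>p\<close>.\<close>
      moreover have "q * x \<noteq> p" if "x \<le> p"
        using mult_left_mono[OF that, of q] mult_strict_right_mono[OF q(2) p(1)] q by linarith
      ultimately show "y \<in> X"
        using x by (auto simp: X_def \<phi>_def)
    next
      fix y assume "y \<in> X"
      then have y: "y \<in> M" "y \<noteq> p"
        by (auto simp: X_def)
      show "y \<in> \<phi> ` M"
      proof (cases "p < y")
        case True
        then show ?thesis
          using y by (intro image_eqI[of _ _ y]) (auto simp: \<phi>_def)
      next
        case False
        show ?thesis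
        proof (cases "y = 0")
          case True
          then show ?thesis
            using p by (intro image_eqI[of _ _ 0]) (auto simp: \<phi>_def M_def)
        next
          case False
          then obtain n where n: "y = q ^ n"
            using y by (auto simp: M_def)
          \<comment> \<open>With \<open>n = Suc m\<close> this gives \<open>m \<ge> k\<close>, so
            \<open>q ^ m\<close> is in the shifted range and is the preimage of
            \<open>y\<close>.\<close>
          have "k < n"
          proof (rule ccontr)
            assume "\<not> k < n"
            then have "p \<le> y"
              using pow_mono[of n k] by (simp add: n p_def)
            then show False
              using y \<open>\<not> p < y\<close> by simp
          qed
          then obtain m where m: "n = Suc m" "k \<le> m"
            by (cases n) auto
          then have "q ^ m \<le> p"
            using pow_mono[of k m] by (simp add: p_def)
          then show ?thesis
            by (intro image_eqI[of _ _ "q ^ m"]) (auto simp: \<phi>_def M_def n m)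
        qed
      qed
    qed
    have \<phi>_le: "\<phi> x \<le> x" "x \<le> \<phi> x + (1 - q) * p" if "x \<in> M" for x
      using M_nonneg[OF that] q p mult_left_mono[of x p "1 - q"] mult_right_mono[of q 1 x]
      by (auto simp: \<phi>_def algebra_simps)
    \<comment> \<open>\<open>max_dist\<close> drops to \<open>0\<close> on the diagonal, so a
      collision could destroy a large distance. In the mixed case the images stay on different sides
      of \<open>p\<close>.\<close>
    have \<phi>_inj: "\<phi> x \<noteq> \<phi> y" if "x \<in> M" "y \<in> M" "x \<noteq> y" for x y
      using that q \<phi>_le(1)[of x] \<phi>_le(1)[of y] by (auto simp: \<phi>_def split: if_splits)
    have \<phi>_M: "\<phi> x \<in> M" if "x \<in> M" for x
      using onto X that by blast
    have "gromov_hausdorff_distance (submetric Z X) Z \<le> ennreal ((1 - q) * p / 2)"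
    proof (rule gromov_hausdorff_distance_le_distortion[where \<phi> = \<phi>])
      show "\<phi> ` mspace Z = mspace (submetric Z X)"
        using onto X by auto
      show "0 < (1 - q) * p / 2"
        using q p by simp
      fix x y assume xy: "x \<in> mspace Z" "y \<in> mspace Z"
      then show "mdist (submetric Z X) (\<phi> x) (\<phi> y) \<le> mdist Z x y"
        using \<phi>_le(1)[of x] \<phi>_le(1)[of y] \<phi>_inj[of x y] \<phi>_M
        by (auto simp: d max_dist_def)
      show "mdist Z x y \<le> mdist (submetric Z X) (\<phi> x) (\<phi> y) + 2 * ((1 - q) * p / 2)"
      proof (cases "x = y")
        case True
        then show ?thesis
          using xy q p by (simp add: d \<phi>_M max_dist_def)
      next
        case False
        \<comment> \<open>Off the diagonal both distances are maxima, and each argument falls by at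
          most \<open>(1 - q) * p\<close>.\<close>
        then have "max x y \<le> max (\<phi> x) (\<phi> y) + (1 - q) * p"
          using xy \<phi>_le(2)[of x] \<phi>_le(2)[of y] by (simp add: max_def)
        then show ?thesis
          using False xy \<phi>_inj[of x y] by (simp add: d \<phi>_M max_dist_def)
      qed
    qed
    \<comment> \<open>Strictness comes from the factor \<open>1/2\<close>, since
      \<open>1 - q\<close> may equal \<open>\<epsilon>\<close>.\<close>
    also have "\<dots> < ennreal (\<epsilon> * p)"
    proof (rule ennreal_lessI)
      show "0 < \<epsilon> * p"
        using assms p by simp
      have "(1 - q) * p \<le> \<epsilon> * p"
        using q p by (intro mult_right_mono) auto
      then show "(1 - q) * p / 2 < \<epsilon> * p"
        using \<open>0 < \<epsilon> * p\<close> by linarith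
    qed
    also have "\<dots> = ennreal \<epsilon> * ennreal p"
      using assms p by (simp add: ennreal_mult)
    also have "\<dots> \<le> ennreal \<epsilon> * hausdorff_distance Z X M"
      using H_ge by (rule mult_left_mono) simp
    finally have "gromov_hausdorff_distance (submetric Z X) Z
        < ennreal \<epsilon> * hausdorff_distance Z X M" .
    moreover have "hausdorff_distance Z X M < ennreal \<delta>"
      using H_le p by (elim le_less_trans) (simp add: ennreal_lessI)
    ultimately show ?thesis
      using X by blast
  qed
  ultimately show ?thesis
    by (intro exI[of _ Z]) (simp add: M_def)
qed

end
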